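(* For every integer $n\geq 3$ there is a constant $C_n>0$ such that $$t^n\;\leq\;|\mathcal{R}_n(t)|\;\leq\;C_n\, t^n$$ for all real $t\geq 1$.
   Context: For a polynomial $p(X)=a_nX^n+\cdots+a_1X+a_0\in\mathbb{Z}[X]$ its height is $H(p)=\max\{|a_i| : i=0,1,\dots,n\}$. For an integer $n\geq 2$ and real $t\geq 1$, $\mathcal{R}_n(t)$ denotes the set of all polynomials $p(X)\in\mathbb{Z}[X]$ of degree exactly $n$ (i.e. $a_n\neq 0$) with $H(p)\leq t$ which are reducible in $\mathbb{Q}[X]$ (equivalently, $p$ is a product of two polynomials in $\mathbb{Z}[X]$ each of degree less than $n$). *)

theory Defs
  imports Complex_Main "HOL-Computational_Algebra.Polynomial"
begin

definition height :: "int poly \<Rightarrow> int" where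
  "height p = Max ((\<lambda>i. \<bar>coeff p i\<bar>) ` {0..degree p})"

text \<open>
  For \<open>n \<ge> 1\<close> a polynomial of degree \<open>n\<close> is neither zero nor a unit in the rational polynomial
  ring, so there \<open>\<not> irreducible\<close> means reducible in the usual sense.
\<close>

definition reducible_polys :: "nat \<Rightarrow> real \<Rightarrow> int poly set" where
  "reducible_polys n t =
     {p. degree p = n \<and> real_of_int (height p) \<le> t \<and>
         \<not> irreducible (map_poly rat_of_int p)}"

end

theory Submission
  imports "Berlekamp_Zassenhaus.Factor_Bound" Defs
begin

text \<open>
  Lower bound: multiples of \<open>X\<close> are reducible. Upper bound: by Gauss' lemma a reducible \<open>p\<close> of degree
  \<open>n\<close> is \<open>g h\<close> over the integers with \<open>1 \<le> d = deg g \<le> deg h\<close>, and multiplicativity of the Mahler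
  measure gives \<open>H(g) H(h) \<le> K\<close> for some \<open>K = O(H(p))\<close>. There are \<open>O(k^d)\<close> choices of \<open>g\<close> of
  height \<open>k\<close>, and then \<open>O((K/k)^(n-d+1))\<close> choices of \<open>h\<close>. Since \<open>n \<ge> 3\<close>, summing over \<open>k\<close> gives
  \<open>O(K^n)\<close>: for \<open>d = 1\<close> the series of \<open>k^(1-n)\<close> converges, and for \<open>d \<ge> 2\<close> each of the \<open>K\<close> terms
  is at most \<open>K^(n-1)\<close>.
\<close>

section \<open>Counting integer polynomials of bounded degree and height\<close>

text \<open>Only an upper bound on the degree is imposed, so zero is included and the set is a full
  box of \<open>d + 1\<close> free coefficients. Peeling off the constant coefficient with
  \<open>pCons\<close> then counts it exactly.\<close>

definition bounded_polys :: "nat \<Rightarrow> nat \<Rightarrow> int poly set" where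
  "bounded_polys d H = {p. degree p \<le> d \<and> (\<forall>i. \<bar>coeff p i\<bar> \<le> int H)}"

lemma bounded_polys_0: "bounded_polys 0 H = (\<lambda>c. [:c:]) ` {- int H..int H}"
proof (intro Set.set_eqI iffI)
  fix p assume p: "p \<in> bounded_polys 0 H"
  then obtain c where c: "p = [:c:]"
    unfolding bounded_polys_def by (auto elim: degree_eq_zeroE)
  have "\<bar>coeff p 0\<bar> \<le> int H" using p unfolding bounded_polys_def by blast
  then show "p \<in> (\<lambda>c. [:c:]) ` {- int H..int H}" using c by (auto simp: image_iff)
next
  fix p assume "p \<in> (\<lambda>c. [:c:]) ` {- int H..int H}"
  then show "p \<in> bounded_polys 0 H"
    by (auto simp: bounded_polys_def coeff_pCons split: nat.split)
qed

lemma bounded_polys_Suc: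
  "bounded_polys (Suc d) H = (\<lambda>(c, q). pCons c q) ` ({- int H..int H} \<times> bounded_polys d H)"
proof (intro Set.set_eqI iffI)
  fix p assume p: "p \<in> bounded_polys (Suc d) H"
  obtain c q where cq: "p = pCons c q" by (cases p)
  have bnd: "\<bar>coeff p i\<bar> \<le> int H" for i using p unfolding bounded_polys_def by blast
  have "degree q \<le> d" using p cq unfolding bounded_polys_def by (auto split: if_splits)
  moreover have "\<bar>coeff q i\<bar> \<le> int H" for i using bnd[of "Suc i"] cq by simp
  moreover have "\<bar>c\<bar> \<le> int H" using bnd[of 0] cq by simp
  ultimately show "p \<in> (\<lambda>(c, q). pCons c q) ` ({- int H..int H} \<times> bounded_polys d H)"
    using cq unfolding bounded_polys_def by (auto simp: image_iff)
next
  fix p assume "p \<in> (\<lambda>(c, q). pCons c q) ` ({- int H..int H} \<times> bounded_polys d H)"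
  then show "p \<in> bounded_polys (Suc d) H"
    by (auto simp: bounded_polys_def coeff_pCons split: nat.split)
qed

lemma finite_bounded_polys: "finite (bounded_polys d H)"
  by (induction d) (simp_all add: bounded_polys_0 bounded_polys_Suc)

lemma card_bounded_polys: "card (bounded_polys d H) = (2 * H + 1) ^ Suc d"
proof (induction d)
  case 0
  have "inj_on (\<lambda>c. [:c:]) {- int H..int H}" by (auto simp: inj_on_def)
  then show ?case by (simp add: bounded_polys_0 card_image)
next
  case (Suc d)
  have "inj_on (\<lambda>(c, q). pCons c q) ({- int H..int H} \<times> bounded_polys d H)"
    by (auto simp: inj_on_def)
  moreover have "nat (2 * int H + 1) = 2 * H + 1" by simp
  ultimately show ?case
    using Suc by (simp add: bounded_polys_Suc card_image card_cartesian_product)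
qed

lemma bounded_polys_mono:
  assumes "d \<le> e" "H \<le> K"
  shows "bounded_polys d H \<subseteq> bounded_polys e K"
proof
  fix p assume p: "p \<in> bounded_polys d H"
  have "\<bar>coeff p i\<bar> \<le> int K" for i
    using p assms(2) order_trans[of "\<bar>coeff p i\<bar>" "int H" "int K"]
    unfolding bounded_polys_def by auto
  then show "p \<in> bounded_polys e K" using p assms(1) unfolding bounded_polys_def by auto
qed

lemma coeff_le_height: "\<bar>coeff p i\<bar> \<le> height p"
proof (cases "i \<le> degree p")
  case True
  then show ?thesis unfolding height_def by (intro Max_ge) auto
next
  case False
  \<comment> \<open>Beyond the degree the coefficient is 0, so only nonnegativity of the height is
    needed; index 0 always lies in the range of the maximum.\<close>
  have "\<bar>coeff p 0\<bar> \<le> height p" unfolding height_def by (intro Max_ge) auto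
  with False show ?thesis by (simp add: coeff_eq_0)
qed

lemma height_attained: "\<exists>i. height p = \<bar>coeff p i\<bar>"
proof -
  have "height p \<in> (\<lambda>i. \<bar>coeff p i\<bar>) ` {0..degree p}"
    unfolding height_def by (intro Max_in) auto
  then show ?thesis by auto
qed

lemma height_le_iff: "height p \<le> H \<longleftrightarrow> (\<forall>i. \<bar>coeff p i\<bar> \<le> H)"
  using coeff_le_height[of p] height_attained[of p] order_trans by metis

lemma height_pos: "p \<noteq> 0 \<Longrightarrow> height p \<ge> 1"
  using coeff_le_height[of p "degree p"] leading_coeff_0_iff[of p] by linarith

lemma bounded_polys_iff: "p \<in> bounded_polys d H \<longleftrightarrow> degree p \<le> d \<and> height p \<le> int H"
  by (simp add: bounded_polys_def height_le_iff)

text \<open>Degree below \<open>m\<close> means lying in the smaller box with degree bound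
  \<open>m - 1\<close>; \<open>m \<ge> 1\<close> keeps this subtraction from truncating.\<close>

lemma card_degree_eq_bounded:
  assumes "m \<ge> 1"
  shows "card {p \<in> bounded_polys m H. degree p = m} = 2 * H * (2 * H + 1) ^ m"
proof -
  have "{p \<in> bounded_polys m H. degree p = m} = bounded_polys m H - bounded_polys (m - 1) H"
    using assms unfolding bounded_polys_def by auto
  then have "card {p \<in> bounded_polys m H. degree p = m}
      = (2 * H + 1) ^ Suc m - (2 * H + 1) ^ Suc (m - 1)"
    by (simp add: card_Diff_subset finite_bounded_polys bounded_polys_mono card_bounded_polys
        del: power_Suc)
  also have "Suc (m - 1) = m" using assms by simp
  finally show ?thesis by simp
qed

text \<open>A discrete mean value estimate. It shows that the shell between two consecutive boxes is
  one power smaller than the boxes themselves.\<close>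

lemma power_Suc_diff_le:
  fixes a b :: real
  assumes "0 \<le> b" "b \<le> a"
  shows "a ^ Suc m - b ^ Suc m \<le> real (Suc m) * (a - b) * a ^ m"
proof (induction m)
  case (Suc m)
  have "a ^ Suc (Suc m) - b ^ Suc (Suc m) = a * (a ^ Suc m - b ^ Suc m) + (a - b) * b ^ Suc m"
    by (simp add: algebra_simps)
  also have "\<dots> \<le> a * (real (Suc m) * (a - b) * a ^ m) + (a - b) * a ^ Suc m"
    using Suc assms by (intro add_mono mult_left_mono power_mono) auto
  finally show ?case by (simp add: algebra_simps)
qed simp

text \<open>Height exactly \<open>k\<close> is the difference of the boxes for \<open>k\<close> and
  \<open>k - 1\<close>. The exponent \<open>d\<close> in place of \<open>d + 1\<close> is what makes
  the later sum over \<open>k\<close> small enough; the 3 comes from 2k + 1 \<le> 3k.\<close>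

lemma card_height_eq_le:
  assumes "k \<ge> 1"
  shows "real (card {p. degree p \<le> d \<and> height p = int k}) \<le> 2 * real (Suc d) * 3 ^ d * real k ^ d"
proof -
  have "{p. degree p \<le> d \<and> height p = int k} = bounded_polys d k - bounded_polys d (k - 1)"
    using assms by (auto simp: bounded_polys_iff)
  then have "real (card {p. degree p \<le> d \<and> height p = int k})
      = real ((2 * k + 1) ^ Suc d - (2 * (k - 1) + 1) ^ Suc d)"
    by (simp add: card_Diff_subset finite_bounded_polys bounded_polys_mono card_bounded_polys
        del: power_Suc)
  also have "\<dots> = real (2 * k + 1) ^ Suc d - real (2 * (k - 1) + 1) ^ Suc d"
    by (subst of_nat_diff) (auto intro!: power_mono simp del: power_Suc)
  also have "\<dots> \<le> real (Suc d) * (real (2 * k + 1) - real (2 * (k - 1) + 1)) * real (2 * k + 1) ^ d"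
    by (intro power_Suc_diff_le) auto
  also have "real (2 * k + 1) - real (2 * (k - 1) + 1) = 2"
    using assms by (simp add: of_nat_diff)
  also have "real (Suc d) * 2 * real (2 * k + 1) ^ d \<le> real (Suc d) * 2 * (3 * real k) ^ d"
    using assms by (intro mult_left_mono power_mono) auto
  finally show ?thesis by (simp add: power_mult_distrib mult_ac)
qed

section \<open>Comparing height with Mahler measure\<close>

text \<open>Mignotte's coefficient bound, with every binomial coefficient estimated by a power of
  2.\<close>

lemma height_le_mahler_measure: "real_of_int (height p) \<le> 2 ^ degree p * mahler_measure p"
proof -
  obtain i where i: "height p = \<bar>coeff p i\<bar>" using height_attained by blast
  have "real_of_int \<bar>coeff p i\<bar> \<le> real (degree p choose i) * mahler_measure p"
    using Mignotte_bound by simp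
  also have "\<dots> \<le> real (2 ^ degree p) * mahler_measure p"
    by (intro mult_right_mono mahler_measure_ge_0 of_nat_mono binomial_le_pow2)
  finally show ?thesis using i by simp
qed

text \<open>By Landau's inequality the Mahler measure is at most the Euclidean norm of the
  coefficient vector.\<close>

lemma mahler_measure_le_height: "mahler_measure p \<le> real (Suc (degree p)) * real_of_int (height p)"
proof (cases "p = 0")
  case False
  let ?q = "map_poly complex_of_int p" and ?H = "real_of_int (height p)"
  have H: "?H \<ge> 0" using height_pos[OF False] by simp
  have "(\<Sum>a\<leftarrow>coeffs ?q. (cmod a)\<^sup>2) \<le> (\<Sum>a\<leftarrow>coeffs ?q. ?H\<^sup>2)"
  proof (intro sum_list_mono power_mono norm_ge_zero)
    fix a assume "a \<in> set (coeffs ?q)"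
    then obtain i where "a = of_int (coeff p i)"
      by (auto simp: coeffs_def coeff_map_poly split: if_splits)
    then show "cmod a \<le> ?H" using coeff_le_height[of p i] by simp
  qed
  also have "\<dots> = real (Suc (degree p)) * ?H\<^sup>2"
    using False by (simp add: comp_def sum_list_triv length_coeffs_degree)
  \<comment> \<open>The sharper factor would be the square root of the number of coefficients;
    squaring that number avoids the root.\<close>
  also have "\<dots> \<le> (real (Suc (degree p)) * ?H)\<^sup>2"
    unfolding power_mult_distrib
    by (intro mult_right_mono) (auto simp: power2_eq_square)
  finally have "sqrt (\<Sum>a\<leftarrow>coeffs ?q. (cmod a)\<^sup>2) \<le> real (Suc (degree p)) * ?H"
    using H by (intro real_le_lsqrt) (auto intro!: sum_list_nonneg)
  moreover have "mahler_measure p \<le> sqrt (\<Sum>a\<leftarrow>coeffs ?q. (cmod a)\<^sup>2)"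
    using Landau_inequality[of ?q] unfolding mahler_measure_def by simp
  ultimately show ?thesis by linarith
qed (simp add: mahler_measure_def height_def)

text \<open>Pass from heights to Mahler measures, multiply these, and pass back. The two powers of 2
  combine because degrees add.\<close>

lemma height_mult_le:
  assumes "g \<noteq> 0" "h \<noteq> 0"
  shows "real_of_int (height g * height h)
    \<le> 2 ^ degree (g * h) * real (Suc (degree (g * h))) * real_of_int (height (g * h))"
proof -
  have "real_of_int (height g * height h)
      \<le> (2 ^ degree g * mahler_measure g) * (2 ^ degree h * mahler_measure h)"
    unfolding of_int_mult
    using height_pos[OF assms(1)] height_pos[OF assms(2)] mahler_measure_ge_0[of g]
    by (intro mult_mono height_le_mahler_measure) auto
  also have "\<dots> = 2 ^ degree (g * h) * (mahler_measure g * mahler_measure h)"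
    using assms by (simp add: degree_mult_eq power_add)
  also have "mahler_measure g * mahler_measure h = mahler_measure (g * h)"
    by (simp add: mahler_measure_def measure_eq_prod of_int_poly_hom.hom_mult)
  also have "2 ^ degree (g * h) * mahler_measure (g * h)
      \<le> 2 ^ degree (g * h) * (real (Suc (degree (g * h))) * real_of_int (height (g * h)))"
    by (intro mult_left_mono mahler_measure_le_height) auto
  finally show ?thesis by (simp add: mult_ac)
qed

section \<open>Gauss' lemma and the lower bound\<close>

text \<open>Over a field the non-unit factors are nonconstant, and Gauss' lemma makes them integral
  with unchanged degrees. Swapping them if necessary puts the smaller degree first.\<close>

lemma reducible_int_factorization:
  fixes p :: "int poly"
  assumes "degree p \<ge> 1" "\<not> irreducible (map_poly rat_of_int p)"
  obtains g h where "p = g * h" "degree g \<ge> 1" "degree g \<le> degree h"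
proof -
  let ?P = "map_poly rat_of_int p"
  have deg: "degree ?P = degree p" by simp
  then have "?P \<noteq> 0" "\<not> ?P dvd 1" using assms(1) by (auto simp: poly_dvd_1)
  with assms(2) obtain a b where ab: "?P = a * b" "\<not> a dvd 1" "\<not> b dvd 1"
    unfolding irreducible_def by blast
  have "a \<noteq> 0" "b \<noteq> 0" using ab(1) \<open>?P \<noteq> 0\<close> by auto
  then have dab: "degree a \<ge> 1" "degree b \<ge> 1"
    using ab(2,3) by (auto simp: is_unit_iff_degree Suc_le_eq)
  obtain g h where gh: "p = g * h" "degree g = degree a" "degree h = degree b"
    using rat_to_int_factor[OF ab(1)] by blast
  show ?thesis
  proof (cases "degree g \<le> degree h")
    case True
    then show ?thesis using that[of g h] gh dab by simp
  next
    case False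
    then show ?thesis using that[of h g] gh dab by (simp add: mult.commute)
  qed
qed

lemma reducible_polys_subset_bounded:
  assumes "t \<ge> 0"
  shows "reducible_polys n t \<subseteq> bounded_polys n (nat \<lfloor>t\<rfloor>)"
  using assms by (auto simp: reducible_polys_def bounded_polys_iff le_floor_iff)

text \<open>The products of X with polynomials of degree exactly \<open>n - 1\<close> suffice;
  \<open>n \<ge> 2\<close> makes the cofactor nonconstant, hence a non-unit.\<close>

lemma card_reducible_polys_ge:
  fixes t :: real
  assumes "n \<ge> 2" "t \<ge> 1"
  shows "t ^ n \<le> real (card (reducible_polys n t))"
proof -
  define T where "T = nat \<lfloor>t\<rfloor>"
  define m where "m = n - 1"
  have m: "n = Suc m" "m \<ge> 1" using assms(1) by (auto simp: m_def)
  have T: "T \<ge> 1" "t \<le> real T + 1" "real T \<le> t" using assms(2) unfolding T_def by linarith+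
  let ?Q = "{q \<in> bounded_polys m T. degree q = m}"
  have sub: "pCons 0 ` ?Q \<subseteq> reducible_polys n t"
  proof
    fix p assume "p \<in> pCons 0 ` ?Q"
    then obtain q where q: "p = pCons 0 q" "q \<in> bounded_polys m T" "degree q = m" by auto
    have q0: "q \<noteq> 0" using q(3) m by auto
    have "p \<in> bounded_polys (Suc m) T"
      unfolding bounded_polys_Suc using q by (auto simp: image_iff)
    then have h: "real_of_int (height p) \<le> t"
      using T(3) by (auto simp: bounded_polys_iff)
    have "\<not> irreducible (map_poly rat_of_int p)"
    proof
      assume irr: "irreducible (map_poly rat_of_int p)"
      have "map_poly rat_of_int p = [:0, 1:] * map_poly rat_of_int q"
        using q(1) q0 by (simp add: map_poly_pCons)
      from irreducibleD[OF irr this]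
      have "degree [:0, 1 :: rat:] = 0 \<or> degree (map_poly rat_of_int q) = 0"
        using q0 by (simp add: is_unit_iff_degree)
      then show False using q(3) m(2) by simp
    qed
    then show "p \<in> reducible_polys n t"
      using h q q0 m(1) by (simp add: reducible_polys_def)
  qed
  have "t ^ n \<le> (real T + 1) ^ n" using T assms(2) by (intro power_mono) auto
  also have "\<dots> = (real T + 1) * (real T + 1) ^ m" by (simp add: m(1))
  \<comment> \<open>As T \<ge> 1, the 2T nonzero choices of the leading coefficient make up for
    rounding \<open>t\<close> down.\<close>
  also have "\<dots> \<le> (2 * real T) * (2 * real T + 1) ^ m"
    using T(1) by (intro mult_mono power_mono) auto
  also have "\<dots> = real (card ?Q)"
    by (simp add: card_degree_eq_bounded[OF m(2)] add.commute)
  also have "card ?Q = card (pCons 0 ` ?Q)"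
    by (intro card_image[symmetric]) (auto simp: inj_on_def)
  also have "real \<dots> \<le> real (card (reducible_polys n t))"
    using sub finite_subset[OF reducible_polys_subset_bounded finite_bounded_polys] assms(2)
    by (intro of_nat_mono card_mono) auto
  finally show ?thesis .
qed

section \<open>Summation over factor heights and the upper bound\<close>

lemma sum_inverse_squares_le: "(\<Sum>k=1..K. 1 / (real k)\<^sup>2) \<le> 2"
proof -
  \<comment> \<open>The subtracted term lets the induction telescope. At \<open>K = 0\<close> it is
    0, since division by zero yields 0, so the step to \<open>K = 1\<close> is treated
    separately.\<close>
  have "(\<Sum>k=1..K. 1 / (real k)\<^sup>2) \<le> 2 - 1 / real K"
  proof (induction K)
    case (Suc K)
    show ?case
    proof (cases "K = 0")
      case False
      then have "1 / (real (Suc K))\<^sup>2 \<le> 1 / real K - 1 / real (Suc K)"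
        by (simp add: divide_simps power2_eq_square)
      with Suc show ?thesis by simp
    qed simp
  qed simp
  moreover have "1 / real K \<ge> 0" by simp
  ultimately show ?thesis by linarith
qed

lemma sum_height_pairs_le:
  assumes "n \<ge> 3" "1 \<le> d" "2 * d \<le> n" "K \<ge> 1"
  shows "(\<Sum>k=1..K. real k ^ d * (real K / real k) ^ Suc (n - d)) \<le> 2 * real K ^ n"
proof (cases "d = 1")
  case True
  have "(\<Sum>k=1..K. real k ^ d * (real K / real k) ^ Suc (n - d))
      \<le> (\<Sum>k=1..K. real K ^ n * (1 / (real k)\<^sup>2))"
  proof (rule sum_mono)
    fix k assume "k \<in> {1..K}"
    then have k: "real k \<ge> 1" by simp
    have n: "Suc (n - d) = n" "n = Suc (n - 1)" using True assms(1) by auto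
    have "real k ^ d * (real K / real k) ^ Suc (n - d) = real K ^ n * (real k / real k ^ n)"
      using True n(1) by (simp add: power_divide)
    also have "real k / real k ^ n = 1 / real k ^ (n - 1)"
      using k by (subst n(2)) (simp add: field_simps)
    also have "real K ^ n * \<dots> \<le> real K ^ n * (1 / (real k)\<^sup>2)"
      using k assms(1) by (intro mult_left_mono divide_left_mono power_increasing) auto
    finally show "real k ^ d * (real K / real k) ^ Suc (n - d) \<le> real K ^ n * (1 / (real k)\<^sup>2)" .
  qed
  also have "\<dots> = real K ^ n * (\<Sum>k=1..K. 1 / (real k)\<^sup>2)"
    by (simp only: sum_distrib_left)
  also have "\<dots> \<le> real K ^ n * 2"
    by (intro mult_left_mono sum_inverse_squares_le) auto
  finally show ?thesis by simp
next
  case False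
  have "(\<Sum>k=1..K. real k ^ d * (real K / real k) ^ Suc (n - d))
      \<le> (\<Sum>k=1..K. real K ^ Suc (n - d))"
  proof (rule sum_mono)
    fix k assume "k \<in> {1..K}"
    then have k: "real k \<ge> 1" by simp
    \<comment> \<open>From 2d \<le> n follows d \<le> n - d + 1, so raising the exponent of k lets k
      cancel.\<close>
    have "real k ^ d * (real K / real k) ^ Suc (n - d)
        \<le> real k ^ Suc (n - d) * (real K / real k) ^ Suc (n - d)"
      using k assms(3) by (intro mult_right_mono power_increasing) auto
    also have "\<dots> = real K ^ Suc (n - d)"
      using k by (simp add: power_mult_distrib[symmetric] del: power_Suc)
    finally show "real k ^ d * (real K / real k) ^ Suc (n - d) \<le> real K ^ Suc (n - d)" .
  qed
  also have "\<dots> = real K ^ Suc (Suc (n - d))" by simp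
  \<comment> \<open>The number of terms contributed one more factor K; \<open>d \<ge> 2\<close>
    absorbs it.\<close>
  also have "\<dots> \<le> real K ^ n"
    using assms False by (intro power_increasing) auto
  also have "\<dots> \<le> 2 * real K ^ n" by simp
  finally show ?thesis .
qed

text \<open>The union contains every product of factors with degrees at most \<open>d\<close> and
  \<open>n - d\<close>, both nonzero, whose heights multiply to at most \<open>K\<close>, sorted by
  the exact height of the first. Repeated products do no harm to an upper bound.\<close>

lemma card_products_le:
  assumes "n \<ge> 3" "1 \<le> d" "2 * d \<le> n" "K \<ge> 1"
  shows "real (card (\<Union>k\<in>{1..K}. (\<lambda>(g, h). g * h) `
      ({g. degree g \<le> d \<and> height g = int k} \<times> bounded_polys (n - d) (K div k))))
    \<le> 4 * real (Suc n) * 3 ^ Suc n * real K ^ n"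
    (is "real (card (\<Union>k\<in>_. ?f ` (?S k \<times> ?B k))) \<le> _")
proof -
  have fin: "finite (?S k)" for k
    by (rule finite_subset[OF _ finite_bounded_polys[of d k]]) (auto simp: bounded_polys_iff)
  have "card (\<Union>k\<in>{1..K}. ?f ` (?S k \<times> ?B k)) \<le> (\<Sum>k=1..K. card (?f ` (?S k \<times> ?B k)))"
    by (rule card_UN_le) simp
  also have "\<dots> \<le> (\<Sum>k=1..K. card (?S k) * card (?B k))"
    unfolding card_cartesian_product[symmetric]
    by (intro sum_mono card_image_le finite_cartesian_product fin finite_bounded_polys)
  finally have "real (card (\<Union>k\<in>{1..K}. ?f ` (?S k \<times> ?B k)))
      \<le> real (\<Sum>k=1..K. card (?S k) * card (?B k))"
    by (rule of_nat_mono)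
  also have "\<dots> = (\<Sum>k=1..K. real (card (?S k)) * real (card (?B k)))" by simp
  also have "\<dots> \<le> (\<Sum>k=1..K. (2 * real (Suc n) * 3 ^ Suc n) *
      (real k ^ d * (real K / real k) ^ Suc (n - d)))"
  proof (rule sum_mono)
    fix k assume "k \<in> {1..K}"
    then have k: "1 \<le> k" "k \<le> K" by auto
    have "real (2 * (K div k) + 1) \<le> 2 * (real K / real k) + 1"
      using of_nat_div_le_of_nat[of K k, where ?'a = real] by linarith
    \<comment> \<open>Here k \<le> K is used: the summand 1 is at most K/k.\<close>
    also have "\<dots> \<le> 3 * (real K / real k)"
      using k by (simp add: field_simps)
    finally have "real (card (?B k)) \<le> (3 * (real K / real k)) ^ Suc (n - d)"
      unfolding card_bounded_polys semiring_1_class.of_nat_power by (intro power_mono) auto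
    with card_height_eq_le[OF k(1), of d]
    have "real (card (?S k)) * real (card (?B k))
        \<le> (2 * real (Suc d) * 3 ^ d * real k ^ d) * (3 * (real K / real k)) ^ Suc (n - d)"
      by (intro mult_mono) auto
    also have "\<dots> = (2 * real (Suc d) * 3 ^ (d + Suc (n - d))) *
        (real k ^ d * (real K / real k) ^ Suc (n - d))"
      unfolding power_mult_distrib power_add by (simp only: mult_ac)
    also have "d + Suc (n - d) = Suc n" using assms(3) by simp
    also have "(2 * real (Suc d) * 3 ^ Suc n) * (real k ^ d * (real K / real k) ^ Suc (n - d))
        \<le> (2 * real (Suc n) * 3 ^ Suc n) * (real k ^ d * (real K / real k) ^ Suc (n - d))"
      using assms(3) by (intro mult_right_mono) auto
    finally show "real (card (?S k)) * real (card (?B k)) \<le> \<dots>" .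
  qed
  also have "\<dots> = (2 * real (Suc n) * 3 ^ Suc n) *
      (\<Sum>k=1..K. real k ^ d * (real K / real k) ^ Suc (n - d))"
    by (simp only: sum_distrib_left)
  also have "\<dots> \<le> (2 * real (Suc n) * 3 ^ Suc n) * (2 * real K ^ n)"
    by (intro mult_left_mono sum_height_pairs_le assms) auto
  also have "\<dots> = 4 * real (Suc n) * 3 ^ Suc n * real K ^ n" by (simp add: algebra_simps)
  finally show ?thesis .
qed

lemma card_reducible_polys_le:
  fixes t :: real
  assumes "n \<ge> 3" "t \<ge> 1"
  shows "real (card (reducible_polys n t))
    \<le> real n * (4 * real (Suc n) * 3 ^ Suc n) * (2 ^ n * real (Suc n)) ^ n * t ^ n"
proof -
  \<comment> \<open>\<open>A\<close> is the constant of \<open>height_mult_le\<close> in degree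
    \<open>n\<close>. The product of the two heights is an integer, so its bound
    \<open>A * t\<close> may be rounded down to \<open>K\<close>.\<close>
  define A :: real where "A = 2 ^ n * real (Suc n)"
  define K where "K = nat \<lfloor>A * t\<rfloor>"
  have A: "A \<ge> 1" unfolding A_def using mult_mono[of 1 "2 ^ n" 1 "real (Suc n)"] by simp
  have At: "A * t \<ge> 1" using A assms(2) mult_mono[of 1 A 1 t] by simp
  have K: "K \<ge> 1" "real K \<le> A * t" using At unfolding K_def by linarith+
  define P where "P d = (\<Union>k\<in>{1..K}. (\<lambda>(g, h). g * h) `
      ({g. degree g \<le> d \<and> height g = int k} \<times> bounded_polys (n - d) (K div k)))" for d
  have finP: "finite (P d)" for d
    unfolding P_def
    by (intro finite_UN_I finite_imageI finite_cartesian_product finite_bounded_polys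
        finite_subset[OF _ finite_bounded_polys[of d K]]) (auto simp: bounded_polys_iff)
  have sub: "reducible_polys n t \<subseteq> (\<Union>d\<in>{1..n div 2}. P d)"
  proof
    fix p assume "p \<in> reducible_polys n t"
    then have p: "degree p = n" "real_of_int (height p) \<le> t" "\<not> irreducible (map_poly rat_of_int p)"
      by (auto simp: reducible_polys_def)
    obtain g h where gh: "p = g * h" "degree g \<ge> 1" "degree g \<le> degree h"
      using reducible_int_factorization[OF _ p(3)] p(1) assms(1) by auto
    have nz: "g \<noteq> 0" "h \<noteq> 0" using gh p(1) assms(1) by auto
    have deg: "degree g + degree h = n" using gh(1) p(1) nz by (simp add: degree_mult_eq)
    define k where "k = nat (height g)"
    define l where "l = nat (height h)"
    have kl: "height g = int k" "height h = int l" "k \<ge> 1" "l \<ge> 1"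
      using height_pos[OF nz(1)] height_pos[OF nz(2)] by (auto simp: k_def l_def)
    have "real_of_int (height g * height h) \<le> A * real_of_int (height p)"
      using height_mult_le[OF nz] gh(1) p(1) unfolding A_def by simp
    also have "\<dots> \<le> A * t" using p(2) A by (intro mult_left_mono) auto
    finally have "real (k * l) \<le> A * t" by (simp add: kl)
    then have klK: "k * l \<le> K" unfolding K_def by (simp add: le_nat_floor)
    \<comment> \<open>Integrality of \<open>l\<close> turns k l \<le> K into the bound by the
      rounded quotient.\<close>
    have "l \<le> K div k" using klK kl(3) by (simp add: less_eq_div_iff_mult_less_eq mult.commute)
    moreover have "k \<le> K" using klK kl(4) by (metis dual_order.trans mult.right_neutral mult_le_mono2)
    ultimately have "p \<in> P (degree g)"
      unfolding P_def using gh(1) kl deg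
      by (intro UN_I[of k] image_eqI[of _ _ "(g, h)"]) (auto simp: bounded_polys_iff)
    then show "p \<in> (\<Union>d\<in>{1..n div 2}. P d)" using gh deg by (intro UN_I[of "degree g"]) auto
  qed
  have "card (reducible_polys n t) \<le> card (\<Union>d\<in>{1..n div 2}. P d)"
    using sub finP by (intro card_mono) auto
  also have "\<dots> \<le> (\<Sum>d=1..n div 2. card (P d))" by (rule card_UN_le) simp
  finally have "real (card (reducible_polys n t)) \<le> real (\<Sum>d=1..n div 2. card (P d))"
    by (rule of_nat_mono)
  also have "\<dots> = (\<Sum>d=1..n div 2. real (card (P d)))" by simp
  also have "\<dots> \<le> (\<Sum>d=1..n div 2. 4 * real (Suc n) * 3 ^ Suc n * real K ^ n)"
    unfolding P_def using assms(1) K(1) by (intro sum_mono card_products_le) auto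
  also have "\<dots> = real (n div 2) * (4 * real (Suc n) * 3 ^ Suc n * real K ^ n)" by simp
  also have "\<dots> \<le> real n * (4 * real (Suc n) * 3 ^ Suc n * (A * t) ^ n)"
    using K by (intro mult_mono power_mono) auto
  finally show ?thesis unfolding A_def[symmetric] by (simp add: power_mult_distrib mult_ac)
qed

theorem theorem1:
  fixes n :: nat
  assumes "n \<ge> 3"
  shows "\<exists>C::real. C > 0 \<and>
    (\<forall>t::real. t \<ge> 1 \<longrightarrow>
      t ^ n \<le> real (card (reducible_polys n t)) \<and>
      real (card (reducible_polys n t)) \<le> C * t ^ n)"
proof (intro exI conjI allI impI)
  show "real n * (4 * real (Suc n) * 3 ^ Suc n) * (2 ^ n * real (Suc n)) ^ n > 0"
    using assms by simp
  fix t :: real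
  assume "t \<ge> 1"
  then show "t ^ n \<le> real (card (reducible_polys n t))"
    "real (card (reducible_polys n t))
      \<le> real n * (4 * real (Suc n) * 3 ^ Suc n) * (2 ^ n * real (Suc n)) ^ n * t ^ n"
    using assms by (auto intro!: card_reducible_polys_ge card_reducible_polys_le
        simp del: power_Suc of_nat_Suc)
qed

end
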